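(* Let $N\ge1$. Every quantum network that solves the search problem on black-boxes $X\in\{0,1\}^N$ exactly or with zero error makes at least $N$ queries.
   Context: Quantum networks: the input $X=(x_0,\ldots,x_{N-1})\in\{0,1\}^N$ is given as a black-box. A quantum network with $T$ queries acts on $m$ qubits (for some $m$) and is a sequence of unitary transformations $U_0,O,U_1,O,\ldots,U_{T-1},O,U_T$ applied in this order to the initial state $|0\rangle$, where the $U_j$ are arbitrary unitaries on $m$ qubits not depending on $X$, and the query $O$ (depending on $X$) maps each basis state $|i,b,z\rangle$ to $|i,b\oplus x_i,z\rangle$; here $i$ consists of $\lceil\log_2 N\rceil$ bits, $b$ is one bit, and $z$ consists of the remaining $m-\lceil\log_2 N\rceil-1$ bits (if $i\ge N$, the query leaves the basis state unchanged). The final state is measured in the computational basis. Search problem: find an index $i$ such that $x_i=1$, if one exists. Each computational basis state observed at the end is interpreted, by a fixed rule not depending on $X$, as one of the outputs: an index $i\in\{0,\ldots,N-1\}$, "no solution", or "inconclusive". An output is correct for $X$ if it is an index $i$ with $x_i=1$, or if it is "no solution" and $X=(0,\ldots,0)$. The network solves search exactly if for every $X\in\{0,1\}^N$ its output is correct with certainty. It solves search with zero error if for every $X$ the output, whenever it is not "inconclusive", is correct with certainty, and the probability of "inconclusive" is less than $1/2$. *)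

theory Defs
  imports
    "HOL-Library.Log_Nat"
    "Jordan_Normal_Form.Schur_Decomposition"
begin

text \<open>
  A black-box \<open>X \<in> {0,1}\<^sup>N\<close> is a list of \<open>N\<close> Booleans. The state space of \<open>m\<close> qubits is
  \<open>\<complex>\<^bsup>2^m\<^esup>\<close>; the computational basis state \<open>|i,b,z\<rangle>\<close> is the unit vector whose index is the
  number with binary representation \<open>i b z\<close>, most significant bits first.
\<close>

definition work_bits :: "nat \<Rightarrow> nat \<Rightarrow> nat" where
  "work_bits N m = m - ceillog2 N - 1"

definition basis_index :: "nat \<Rightarrow> nat \<Rightarrow> nat \<Rightarrow> bool \<Rightarrow> nat \<Rightarrow> nat" where
  "basis_index N m i b z = (2 * i + of_bool b) * 2 ^ work_bits N m + z"

definition index_part :: "nat \<Rightarrow> nat \<Rightarrow> nat \<Rightarrow> nat" where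
  "index_part N m k = k div 2 ^ work_bits N m div 2"

definition target_bit :: "nat \<Rightarrow> nat \<Rightarrow> nat \<Rightarrow> bool" where
  "target_bit N m k = odd (k div 2 ^ work_bits N m)"

definition work_part :: "nat \<Rightarrow> nat \<Rightarrow> nat \<Rightarrow> nat" where
  "work_part N m k = k mod 2 ^ work_bits N m"

text \<open>Inequality of Booleans is exclusive or. For \<open>i \<ge> N\<close> nothing is added to the target bit.\<close>

definition query_index :: "nat \<Rightarrow> nat \<Rightarrow> bool list \<Rightarrow> nat \<Rightarrow> nat" where
  "query_index N m X k =
     (let i = index_part N m k
      in basis_index N m i (target_bit N m k \<noteq> (i < N \<and> X ! i)) (work_part N m k))"

definition query_mat :: "nat \<Rightarrow> nat \<Rightarrow> bool list \<Rightarrow> complex mat" where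
  "query_mat N m X =
     mat (2 ^ m) (2 ^ m) (\<lambda>(r, c). if r = query_index N m X c then 1 else 0)"

definition unitary_mat :: "nat \<Rightarrow> complex mat \<Rightarrow> bool" where
  "unitary_mat d U \<longleftrightarrow>
     U \<in> carrier_mat d d \<and> mat_adjoint U * U = 1\<^sub>m d \<and> U * mat_adjoint U = 1\<^sub>m d"

text \<open>
  The network with \<open>T\<close> queries is given by \<open>U 0, \<dots>, U T\<close>; the values \<open>U j\<close> for \<open>j > T\<close> are irrelevant.
\<close>

definition quantum_network :: "nat \<Rightarrow> nat \<Rightarrow> nat \<Rightarrow> (nat \<Rightarrow> complex mat) \<Rightarrow> bool" where
  "quantum_network N m T U \<longleftrightarrow>
     ceillog2 N + 1 \<le> m \<and> (\<forall>j\<le>T. unitary_mat (2 ^ m) (U j))"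

fun network_state ::
  "nat \<Rightarrow> nat \<Rightarrow> (nat \<Rightarrow> complex mat) \<Rightarrow> bool list \<Rightarrow> nat \<Rightarrow> complex vec" where
  "network_state N m U X 0 = U 0 *\<^sub>v unit_vec (2 ^ m) 0"
| "network_state N m U X (Suc t) =
     U (Suc t) *\<^sub>v (query_mat N m X *\<^sub>v network_state N m U X t)"

datatype search_output = Index nat | No_Solution | Inconclusive

fun correct_output :: "nat \<Rightarrow> bool list \<Rightarrow> search_output \<Rightarrow> bool" where
  "correct_output N X (Index i) \<longleftrightarrow> i < N \<and> X ! i"
| "correct_output N X No_Solution \<longleftrightarrow> (\<forall>i<N. \<not> X ! i)"
| "correct_output N X Inconclusive \<longleftrightarrow> False"

definition output_rule :: "nat \<Rightarrow> nat \<Rightarrow> (nat \<Rightarrow> search_output) \<Rightarrow> bool" where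
  "output_rule N m R \<longleftrightarrow> (\<forall>k<2 ^ m. R k \<in> Index ` {..<N} \<union> {No_Solution, Inconclusive})"

text \<open>The probability that the output, obtained by measuring the final state, satisfies \<open>P\<close>.\<close>

definition output_prob ::
  "nat \<Rightarrow> nat \<Rightarrow> nat \<Rightarrow> (nat \<Rightarrow> complex mat) \<Rightarrow> (nat \<Rightarrow> search_output) \<Rightarrow> bool list \<Rightarrow>
   (search_output \<Rightarrow> bool) \<Rightarrow> real" where
  "output_prob N m T U R X P =
     (\<Sum>k | k < 2 ^ m \<and> P (R k). (cmod (network_state N m U X T $ k))\<^sup>2)"

definition solves_search_exactly ::
  "nat \<Rightarrow> nat \<Rightarrow> nat \<Rightarrow> (nat \<Rightarrow> complex mat) \<Rightarrow> (nat \<Rightarrow> search_output) \<Rightarrow> bool" where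
  "solves_search_exactly N m T U R \<longleftrightarrow>
     (\<forall>X. length X = N \<longrightarrow> output_prob N m T U R X (correct_output N X) = 1)"

definition solves_search_zero_error ::
  "nat \<Rightarrow> nat \<Rightarrow> nat \<Rightarrow> (nat \<Rightarrow> complex mat) \<Rightarrow> (nat \<Rightarrow> search_output) \<Rightarrow> bool" where
  "solves_search_zero_error N m T U R \<longleftrightarrow>
     (\<forall>X. length X = N \<longrightarrow>
        output_prob N m T U R X (\<lambda>a. a \<noteq> Inconclusive \<longrightarrow> correct_output N X a) = 1 \<and>
        output_prob N m T U R X (\<lambda>a. a = Inconclusive) < 1 / 2)"

lemma basis_index_parts:
  assumes "z < 2 ^ work_bits N m"
  shows "index_part N m (basis_index N m i b z) = i"
    and "target_bit N m (basis_index N m i b z) = b"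
    and "work_part N m (basis_index N m i b z) = z"
  using assms
  by (auto simp: index_part_def target_bit_def work_part_def basis_index_def)

lemma basis_index_less:
  assumes "ceillog2 N + 1 \<le> m" "i < 2 ^ ceillog2 N" "z < 2 ^ work_bits N m"
  shows "basis_index N m i b z < 2 ^ m"
proof -
  have "2 * i + of_bool b + 1 \<le> 2 * 2 ^ ceillog2 N"
    using assms(2) by (cases b) auto
  then have "(2 * i + of_bool b + 1) * 2 ^ work_bits N m \<le> 2 * 2 ^ ceillog2 N * 2 ^ work_bits N m"
    by (rule mult_right_mono) simp
  also have "\<dots> = 2 ^ (Suc (ceillog2 N) + work_bits N m)"
    by (simp add: power_add)
  also have "Suc (ceillog2 N) + work_bits N m = m"
    using assms(1) by (simp add: work_bits_def)
  finally show ?thesis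
    using assms(3) by (simp add: basis_index_def algebra_simps)
qed

lemma query_mat_basis_state:
  assumes "ceillog2 N + 1 \<le> m" "i < 2 ^ ceillog2 N" "z < 2 ^ work_bits N m"
  shows "query_mat N m X *\<^sub>v unit_vec (2 ^ m) (basis_index N m i b z) =
     unit_vec (2 ^ m) (basis_index N m i (b \<noteq> (i < N \<and> X ! i)) z)"
  by (rule eq_vecI)
    (auto simp: query_mat_def basis_index_less[OF assms] query_index_def Let_def
      basis_index_parts[OF assms(3)])

end

theory Submission
  imports Defs
begin

text \<open>
  The polynomial method. Each query raises the degree of the amplitudes, as polynomials in the bits
  of \<open>X\<close>, by at most one. The amplitude at a basis state read as ``no solution'' vanishes at every
  \<open>X \<noteq> 0\<close>, and for some such state it does not vanish at \<open>X = 0\<close>. The alternating sum of that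
  amplitude over the cube has a single nonzero term, so its degree is \<open>N\<close>.
\<close>

section \<open>Finite differences on subsets and polynomial degree\<close>

text \<open>
  Degree at most \<open>d\<close> is expressed by the vanishing of all iterated differences in more than \<open>d\<close>
  directions, for functions of the set of positions of the ones.
\<close>

definition alt_sum :: "('a set \<Rightarrow> 'b::comm_ring_1) \<Rightarrow> 'a set \<Rightarrow> 'a set \<Rightarrow> 'b" where
  "alt_sum f A B = (\<Sum>S\<in>Pow A. (- 1) ^ card S * f (B \<union> S))"

definition degree_le :: "nat \<Rightarrow> ('a set \<Rightarrow> 'b::comm_ring_1) \<Rightarrow> bool" where
  "degree_le d f \<longleftrightarrow> (\<forall>A B. finite A \<and> d < card A \<longrightarrow> alt_sum f A B = 0)"

text \<open>Split the subsets of \<open>insert i A\<close> by whether they contain \<open>i\<close>;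
  those that do carry one more sign. This is the recursion of iterated differences, taking one
  direction at a time.\<close>

lemma alt_sum_insert:
  assumes "finite A" "i \<notin> A"
  shows "alt_sum f (insert i A) B = alt_sum f A B - alt_sum f A (insert i B)"
proof -
  have "alt_sum f (insert i A) B =
      (\<Sum>S\<in>Pow A. (- 1) ^ card S * f (B \<union> S)) +
      (\<Sum>S\<in>insert i ` Pow A. (- 1) ^ card S * f (B \<union> S))"
    unfolding alt_sum_def Pow_insert using assms by (intro sum.union_disjoint) auto
  also have "(\<Sum>S\<in>insert i ` Pow A. (- 1) ^ card S * f (B \<union> S)) =
      (\<Sum>S\<in>Pow A. (- 1) ^ card (insert i S) * f (B \<union> insert i S))"
    using assms(2) by (subst sum.reindex) (auto intro!: inj_onI simp: o_def)
  also have "\<dots> = (\<Sum>S\<in>Pow A. - ((- 1) ^ card S * f (insert i B \<union> S)))"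
  proof (rule sum.cong)
    fix S assume "S \<in> Pow A"
    with assms have "finite S" "i \<notin> S" by (auto intro: finite_subset)
    then show "(- 1) ^ card (insert i S) * f (B \<union> insert i S) =
        - ((- 1) ^ card S * f (insert i B \<union> S))" by simp
  qed simp
  finally show ?thesis by (simp add: alt_sum_def sum_negf)
qed

lemma degree_le_const: "degree_le d (\<lambda>_. c)"
  unfolding degree_le_def
proof (intro allI impI)
  fix A B :: "'a set" assume "finite A \<and> d < card A"
  then obtain i A' where "A = insert i A'" "i \<notin> A'" "finite A'"
    by (metis card.empty equals0I finite_Diff insertI1 insert_Diff_single insert_absorb
        not_less0 Diff_iff)
  then show "alt_sum (\<lambda>_. c) A B = 0"
    using alt_sum_insert[of A' i "\<lambda>_. c" B] by (simp add: alt_sum_def)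
qed

lemma degree_le_mono: "degree_le d f \<Longrightarrow> d \<le> e \<Longrightarrow> degree_le e f"
  by (auto simp: degree_le_def)

lemma degree_le_add: "degree_le d f \<Longrightarrow> degree_le d g \<Longrightarrow> degree_le d (\<lambda>Y. f Y + g Y)"
  by (simp add: degree_le_def alt_sum_def distrib_left sum.distrib)

lemma degree_le_mult_left: "degree_le d f \<Longrightarrow> degree_le d (\<lambda>Y. c * f Y)"
  by (simp add: degree_le_def alt_sum_def mult.left_commute[of _ c] flip: sum_distrib_left)

lemma degree_le_sum: "(\<And>j. j \<in> J \<Longrightarrow> degree_le d (f j)) \<Longrightarrow> degree_le d (\<lambda>Y. \<Sum>j\<in>J. f j Y)"
  by (induction J rule: infinite_finite_induct) (auto intro: degree_le_const degree_le_add)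

text \<open>In directions other than \<open>i\<close> the factor is constant and leaves the
  alternating sum. If \<open>i\<close> is a direction, splitting it off leaves more than
  \<open>d\<close> directions for \<open>f\<close>, so both resulting terms vanish.\<close>

lemma degree_le_mult_var:
  assumes "degree_le d f"
  shows "degree_le (Suc d) (\<lambda>Y. of_bool (i \<in> Y) * f Y)" (is "degree_le _ ?g")
  unfolding degree_le_def
proof (intro allI impI)
  fix A B :: "'a set" assume A: "finite A \<and> Suc d < card A"
  have eq: "alt_sum ?g A' B' = of_bool (i \<in> B') * alt_sum f A' B'" if "i \<notin> A'" for A' B'
    using that by (auto simp: alt_sum_def intro!: sum.cong sum.neutral)
  show "alt_sum ?g A B = 0"
  proof (cases "i \<in> A")
    case True
    then obtain A' where A': "A = insert i A'" "i \<notin> A'" by (meson mk_disjoint_insert)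
    with A have "finite A'" "d < card A'" by auto
    with assms have "alt_sum f A' C = 0" for C by (auto simp: degree_le_def)
    then show ?thesis using A' \<open>finite A'\<close> by (simp add: alt_sum_insert eq)
  next
    case False
    then show ?thesis using A assms by (auto simp: eq degree_le_def)
  qed
qed

lemma point_function_degree:
  assumes "degree_le d f" "finite A" "f {} \<noteq> 0" "\<And>S. S \<subseteq> A \<Longrightarrow> S \<noteq> {} \<Longrightarrow> f S = 0"
  shows "card A \<le> d"
proof (rule ccontr)
  assume "\<not> card A \<le> d"
  with assms have "alt_sum f A {} = 0" by (auto simp: degree_le_def)
  moreover have "alt_sum f A {} = (\<Sum>S\<in>{{}}. (- 1) ^ card S * f S)"
    unfolding alt_sum_def using assms by (intro sum.mono_neutral_cong_right) auto
  ultimately show False using assms by simp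
qed

section \<open>The query as a permutation of basis states\<close>

text \<open>Elements from \<open>N\<close> on are ignored, so every set of naturals encodes a
  black-box. Amplitudes thus become functions on all sets, the domain over which
  \<open>degree_le\<close> quantifies.\<close>

definition bits_of :: "nat \<Rightarrow> nat set \<Rightarrow> bool list" where
  "bits_of N Y = map (\<lambda>i. i \<in> Y) [0..<N]"

lemma length_bits_of [simp]: "length (bits_of N Y) = N"
  by (simp add: bits_of_def)

lemma nth_bits_of [simp]: "i < N \<Longrightarrow> bits_of N Y ! i \<longleftrightarrow> i \<in> Y"
  by (simp add: bits_of_def)

lemma query_index_involution:
  assumes "ceillog2 N + 1 \<le> m" "k < 2 ^ m"
  shows "query_index N m X k < 2 ^ m" and "query_index N m X (query_index N m X k) = k"
proof -
  let ?w = "2 ^ work_bits N m :: nat"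
  have w: "k mod ?w < ?w" by simp
  have "ceillog2 N + (work_bits N m + 1) = m" using assms by (simp add: work_bits_def)
  then have "(2::nat) ^ m = 2 ^ ceillog2 N * 2 ^ (work_bits N m + 1)"
    by (simp only: flip: power_add)
  then have "(2::nat) ^ m = 2 ^ ceillog2 N * (?w * 2)"
    by (simp only: power_add power_one_right)
  with assms have "k < 2 ^ ceillog2 N * (?w * 2)" by simp
  then have "k div ?w div 2 < 2 ^ ceillog2 N"
    by (simp add: div_mult2_eq[symmetric] less_mult_imp_div_less)
  from basis_index_less[OF assms(1) this w]
  show "query_index N m X k < 2 ^ m"
    by (simp add: query_index_def Let_def index_part_def work_part_def)
  have "basis_index N m (index_part N m k) (target_bit N m k) (work_part N m k) = k"
    by (simp add: basis_index_def index_part_def target_bit_def work_part_def)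
      (metis odd_iff_mod_2_eq_one mod2_eq_if mult_div_mod_eq of_bool_eq mult.commute)
  \<comment> \<open>Adding the same bit twice restores the target bit: the two negations in the
    double exclusive or cancel.\<close>
  moreover have "((b = c) = c) = b" for b c :: bool by blast
  ultimately show "query_index N m X (query_index N m X k) = k"
    using basis_index_parts[OF w]
    by (simp add: query_index_def Let_def work_part_def)
qed

section \<open>Norm preservation\<close>

definition sq_norm :: "complex vec \<Rightarrow> real" where
  "sq_norm v = (\<Sum>k<dim_vec v. (cmod (v $ k))\<^sup>2)"

lemma query_mat_carrier [simp]: "query_mat N m X \<in> carrier_mat (2 ^ m) (2 ^ m)"
  by (simp add: query_mat_def)

lemma query_mat_mult_index:
  assumes "v \<in> carrier_vec (2 ^ m)" "r < 2 ^ m"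
  shows "(query_mat N m X *\<^sub>v v) $ r = (\<Sum>c<2 ^ m. of_bool (r = query_index N m X c) * v $ c)"
proof -
  have "(query_mat N m X *\<^sub>v v) $ r = (\<Sum>c<2 ^ m. query_mat N m X $$ (r, c) * v $ c)"
    using assms by (simp add: scalar_prod_def query_mat_def lessThan_atLeast0)
  then show ?thesis
    using assms(2) by (simp add: query_mat_def of_bool_def)
qed

lemma sq_norm_query_mat:
  assumes "ceillog2 N + 1 \<le> m" "v \<in> carrier_vec (2 ^ m)"
  shows "sq_norm (query_mat N m X *\<^sub>v v) = sq_norm v"
proof -
  let ?q = "query_index N m X"
  note q = query_index_involution[OF assms(1), of _ X]
  have "(query_mat N m X *\<^sub>v v) $ r = v $ ?q r" if "r < 2 ^ m" for r
  proof -
    \<comment> \<open>As \<open>?q\<close> is an involution, row \<open>r\<close> has its only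
      nonzero entry in column \<open>?q r\<close>.\<close>
    have "(\<Sum>c<2 ^ m. of_bool (r = ?q c) * v $ c) = (\<Sum>c\<in>{?q r}. v $ c)"
      using q that by (intro sum.mono_neutral_cong_right) auto
    with that assms show ?thesis by (simp add: query_mat_mult_index)
  qed
  moreover have "(\<Sum>r<2 ^ m. (cmod (v $ ?q r))\<^sup>2) = (\<Sum>r<2 ^ m. (cmod (v $ r))\<^sup>2)"
    by (rule sum.reindex_bij_witness[of _ ?q ?q]) (use q in auto)
  ultimately show ?thesis
    using assms by (simp add: sq_norm_def query_mat_def)
qed

text \<open>Moving \<open>U\<close> across the inner product gives \<open>mat_adjoint U * U\<close>,
  the identity; the computation is written out in coordinates.\<close>

lemma sq_norm_unitary_mat:
  assumes U: "unitary_mat d U" and v: "v \<in> carrier_vec d"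
  shows "sq_norm (U *\<^sub>v v) = sq_norm v"
proof -
  from U have Uc: "U \<in> carrier_mat d d" and UU: "mat_adjoint U * U = 1\<^sub>m d"
    by (auto simp: unitary_mat_def)
  let ?w = "U *\<^sub>v v"
  have adj: "mat_adjoint U \<in> carrier_mat d d"
    using Uc by (auto simp: mat_adjoint_def)
  have w: "?w \<in> carrier_vec d" using Uc v by simp
  have idx: "(\<Sum>k<d. cnj (U $$ (k, j)) * ?w $ k) = v $ j" if "j < d" for j
  proof -
    have "mat_adjoint U *\<^sub>v ?w = v"
      using assoc_mult_mat_vec[OF adj Uc v] UU v by simp
    then have "v $ j = (mat_adjoint U *\<^sub>v ?w) $ j" by simp
    also have "\<dots> = (\<Sum>k<d. mat_adjoint U $$ (j, k) * ?w $ k)"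
      using that adj w carrier_vecD[OF w]
      by (simp add: scalar_prod_def lessThan_atLeast0 del: dim_mult_mat_vec)
    also have "\<dots> = (\<Sum>k<d. cnj (U $$ (k, j)) * ?w $ k)"
      using that Uc by (intro sum.cong) (auto simp: mat_adjoint_def mat_of_rows_def)
    finally show ?thesis ..
  qed
  have norm: "complex_of_real (sq_norm x) = (\<Sum>k<d. x $ k * cnj (x $ k))"
    if "x \<in> carrier_vec d" for x
    using that by (simp add: sq_norm_def complex_norm_square flip: of_real_power)
  have "complex_of_real (sq_norm ?w) = (\<Sum>k<d. ?w $ k * (\<Sum>j<d. cnj (U $$ (k, j)) * cnj (v $ j)))"
    unfolding norm[OF w]
    using Uc v by (intro sum.cong) (auto simp: scalar_prod_def lessThan_atLeast0)
  also have "\<dots> = (\<Sum>k<d. \<Sum>j<d. cnj (U $$ (k, j)) * ?w $ k * cnj (v $ j))"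
    by (simp add: sum_distrib_left mult_ac)
  also have "\<dots> = (\<Sum>j<d. (\<Sum>k<d. cnj (U $$ (k, j)) * ?w $ k) * cnj (v $ j))"
    by (subst sum.swap) (simp add: sum_distrib_right)
  also have "\<dots> = complex_of_real (sq_norm v)"
    unfolding norm[OF v] by (intro sum.cong) (auto simp: idx)
  finally show ?thesis by (simp only: of_real_eq_iff)
qed

lemma network_state_carrier:
  assumes "quantum_network N m T U" "t \<le> T"
  shows "network_state N m U X t \<in> carrier_vec (2 ^ m)"
  using assms
  by (cases t) (auto simp: quantum_network_def unitary_mat_def intro!: carrier_vecI)

lemma sq_norm_network_state:
  assumes "quantum_network N m T U" "t \<le> T"
  shows "sq_norm (network_state N m U X t) = 1"
  using assms(2)
proof (induction t)
  case 0
  have "sq_norm (unit_vec (2 ^ m) 0) = (\<Sum>k<2 ^ m. if k = (0::nat) then 1 else 0)"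
    unfolding sq_norm_def by (rule sum.cong) auto
  also have "\<dots> = 1" by simp
  finally show ?case
    using assms(1) by (simp add: quantum_network_def sq_norm_unitary_mat[of "2 ^ m"])
next
  case (Suc t)
  have "network_state N m U X t \<in> carrier_vec (2 ^ m)"
    using assms(1) Suc.prems by (simp add: network_state_carrier)
  moreover from this have "query_mat N m X *\<^sub>v network_state N m U X t \<in> carrier_vec (2 ^ m)"
    by (rule mult_mat_vec_carrier[OF query_mat_carrier])
  ultimately show ?case
    using assms(1) Suc by (simp add: quantum_network_def sq_norm_unitary_mat[of "2 ^ m"] sq_norm_query_mat)
qed

section \<open>Degrees of the amplitudes\<close>

lemma degree_le_mat_vec:
  assumes "A \<in> carrier_mat d d" "\<And>Y. v Y \<in> carrier_vec d"
    and "\<And>k. k < d \<Longrightarrow> degree_le t (\<lambda>Y. v Y $ k)" and "r < d"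
  shows "degree_le t (\<lambda>Y. (A *\<^sub>v v Y) $ r)"
proof -
  have "(\<lambda>Y. (A *\<^sub>v v Y) $ r) = (\<lambda>Y. \<Sum>k<d. A $$ (r, k) * v Y $ k)"
    using assms(1,4) by (simp add: scalar_prod_def carrier_vecD[OF assms(2)] lessThan_atLeast0)
  moreover have "degree_le t (\<lambda>Y. \<Sum>k<d. A $$ (r, k) * v Y $ k)"
    using assms by (intro degree_le_sum degree_le_mult_left) auto
  ultimately show ?thesis by simp
qed

text \<open>Each entry of the query matrix is affine in a single input bit, so each summand of the
  product gains at most one degree.\<close>

lemma degree_le_query:
  assumes v: "\<And>Y. v Y \<in> carrier_vec (2 ^ m)"
    and deg: "\<And>k. k < 2 ^ m \<Longrightarrow> degree_le t (\<lambda>Y. v Y $ k)" and r: "r < 2 ^ m"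
  shows "degree_le (Suc t) (\<lambda>Y. (query_mat N m (bits_of N Y) *\<^sub>v v Y) $ r)"
proof -
  let ?q = "\<lambda>b c. basis_index N m (index_part N m c) (target_bit N m c \<noteq> b) (work_part N m c)"
  let ?i = "index_part N m"
  let ?a = "\<lambda>c. of_bool (r = ?q False c) :: complex"
  let ?b = "\<lambda>c. of_bool (?i c < N) * (of_bool (r = ?q True c) - ?a c) :: complex"
  \<comment> \<open>Interpolation in the bit at position \<open>?i c\<close>: \<open>?a c\<close> is
    the entry when nothing is added to the target bit, and \<open>?b c\<close> is the change when
    that bit is one. For \<open>?i c\<close> at least \<open>N\<close> this change is zero.\<close>
  have "of_bool (r = query_index N m (bits_of N Y) c) * x = ?a c * x + ?b c * (of_bool (?i c \<in> Y) * x)"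
    for c Y and x :: complex
    by (auto simp: query_index_def Let_def)
  then have "(\<lambda>Y. (query_mat N m (bits_of N Y) *\<^sub>v v Y) $ r) =
      (\<lambda>Y. \<Sum>c<2 ^ m. ?a c * v Y $ c + ?b c * (of_bool (?i c \<in> Y) * v Y $ c))"
    by (simp only: query_mat_mult_index[OF v r])
  moreover have "degree_le (Suc t) \<dots>"
    using deg
    by (intro degree_le_sum degree_le_add degree_le_mult_left degree_le_mult_var)
      (auto intro: degree_le_mono[OF deg])
  ultimately show ?thesis by simp
qed

lemma amplitude_degree:
  assumes "quantum_network N m T U" "t \<le> T" "k < 2 ^ m"
  shows "degree_le t (\<lambda>Y. network_state N m U (bits_of N Y) t $ k)"
  using assms(2,3)
proof (induction t arbitrary: k)
  case 0
  show ?case by (simp add: degree_le_const)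
next
  case (Suc t)
  let ?v = "\<lambda>Y. network_state N m U (bits_of N Y) t"
  have v: "?v Y \<in> carrier_vec (2 ^ m)" for Y
    using assms(1) Suc.prems by (simp add: network_state_carrier)
  have U: "U (Suc t) \<in> carrier_mat (2 ^ m) (2 ^ m)"
    using assms(1) Suc.prems by (simp add: quantum_network_def unitary_mat_def)
  have "degree_le (Suc t) (\<lambda>Y. (query_mat N m (bits_of N Y) *\<^sub>v ?v Y) $ r)" if "r < 2 ^ m" for r
    using Suc that v by (intro degree_le_query) auto
  then show ?case
    unfolding network_state.simps
    by (intro degree_le_mat_vec[OF U]) (auto intro: mult_mat_vec_carrier[OF query_mat_carrier v] Suc.prems)
qed

section \<open>Output probabilities and the lower bound\<close>

lemma output_prob_add_compl:
  assumes "quantum_network N m T U"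
  shows "output_prob N m T U R X P + output_prob N m T U R X (\<lambda>a. \<not> P a) = 1"
proof -
  have "dim_vec (network_state N m U X T) = 2 ^ m"
    using network_state_carrier[OF assms order_refl] by (rule carrier_vecD)
  with sq_norm_network_state[OF assms order_refl, of X]
  have "(\<Sum>k<2 ^ m. (cmod (network_state N m U X T $ k))\<^sup>2) = 1"
    by (simp add: sq_norm_def)
  moreover have "{..<2 ^ m} = {k. k < 2 ^ m \<and> P (R k)} \<union> {k. k < 2 ^ m \<and> \<not> P (R k)}"
    by auto
  ultimately show ?thesis
    unfolding output_prob_def by (subst sum.union_disjoint[symmetric]) auto
qed

text \<open>A sum of squared moduli vanishes only termwise. Working with amplitudes, of degree at
  most \<open>T\<close>, instead of probabilities, whose degree bound would be \<open>2 * T\<close>,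
  yields the bound \<open>N\<close> and not half of it.\<close>

lemma output_prob_eq_0_iff:
  "output_prob N m T U R X P = 0 \<longleftrightarrow>
     (\<forall>k<2 ^ m. P (R k) \<longrightarrow> network_state N m U X T $ k = 0)"
  unfolding output_prob_def by (subst sum_nonneg_eq_0_iff) auto

text \<open>All probability lies on correct outputs, and \<open>Inconclusive\<close> is never
  correct, so it has probability zero. Only the zero-error case then remains.\<close>

lemma exact_imp_zero_error:
  assumes "quantum_network N m T U" "solves_search_exactly N m T U R"
  shows "solves_search_zero_error N m T U R"
  unfolding solves_search_zero_error_def
proof (intro allI impI)
  fix X :: "bool list" assume "length X = N"
  with assms(2) have c: "output_prob N m T U R X (correct_output N X) = 1"
    by (simp add: solves_search_exactly_def)
  note compl = output_prob_add_compl[OF assms(1), of R X]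
  have wrong: "output_prob N m T U R X P = 0" if "\<And>a. P a \<Longrightarrow> \<not> correct_output N X a" for P
    using compl[of "correct_output N X"] c that by (auto simp: output_prob_eq_0_iff)
  let ?P = "\<lambda>a. a \<noteq> Inconclusive \<longrightarrow> correct_output N X a"
  have "output_prob N m T U R X (\<lambda>a. \<not> ?P a) = 0"
    by (rule wrong) auto
  then show "output_prob N m T U R X ?P = 1 \<and> output_prob N m T U R X (\<lambda>a. a = Inconclusive) < 1 / 2"
    using compl[of ?P] wrong[of "\<lambda>a. a = Inconclusive"] by auto
qed

theorem corollary6p2:
  fixes N m T :: nat
    and U :: "nat \<Rightarrow> complex mat"
    and R :: "nat \<Rightarrow> search_output"
  assumes "N \<ge> 1"
    and "quantum_network N m T U"
    and "output_rule N m R"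
    and "solves_search_exactly N m T U R \<or> solves_search_zero_error N m T U R"
  shows "N \<le> T"
proof -
  note network = assms(2)
  let ?p = "\<lambda>Y. output_prob N m T U R (bits_of N Y)"
  let ?amp = "\<lambda>k Y. network_state N m U (bits_of N Y) T $ k"
  have "solves_search_zero_error N m T U R"
    using assms exact_imp_zero_error by blast
  then have conclusive: "?p Y (\<lambda>a. a \<noteq> Inconclusive \<longrightarrow> correct_output N (bits_of N Y) a) = 1"
    and inconclusive: "?p Y (\<lambda>a. a = Inconclusive) < 1 / 2" for Y
    by (simp_all add: solves_search_zero_error_def)
  have "?p Y (\<lambda>a. \<not> (a \<noteq> Inconclusive \<longrightarrow> correct_output N (bits_of N Y) a)) = 0" for Y
    using conclusive[of Y]
      output_prob_add_compl[OF network, of R "bits_of N Y"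
        "\<lambda>a. a \<noteq> Inconclusive \<longrightarrow> correct_output N (bits_of N Y) a"]
    by simp
  then have wrong: "?amp k Y = 0"
    if "k < 2 ^ m" "R k \<noteq> Inconclusive" "\<not> correct_output N (bits_of N Y) (R k)" for k Y
    using that by (simp add: output_prob_eq_0_iff)
  \<comment> \<open>On the all-zero black-box a conclusive output has probability above one half, so
    some conclusive basis state has nonzero amplitude. Its output must be correct, and no index
    is.\<close>
  obtain k where k: "k < 2 ^ m" "R k = No_Solution" "?amp k {} \<noteq> 0"
  proof -
    have "?p {} (\<lambda>a. a \<noteq> Inconclusive) \<noteq> 0"
      using inconclusive[of "{}"] output_prob_add_compl[OF network, of R "bits_of N {}" "\<lambda>a. a = Inconclusive"]
      by auto
    then obtain k where k: "k < 2 ^ m" "R k \<noteq> Inconclusive" "?amp k {} \<noteq> 0"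
      by (auto simp: output_prob_eq_0_iff)
    with wrong[of k "{}"] have "correct_output N (bits_of N {}) (R k)" by blast
    then have "R k = No_Solution" using k(2) by (cases "R k") auto
    with k that show ?thesis by blast
  qed
  have "card {..<N} \<le> T"
  proof (rule point_function_degree)
    show "degree_le T (?amp k)" using network k(1) by (simp add: amplitude_degree)
    \<comment> \<open>A nonempty \<open>S\<close> below \<open>N\<close> puts a one in the
      black-box, which makes \<open>No_Solution\<close> wrong there.\<close>
    show "?amp k S = 0" if "S \<subseteq> {..<N}" "S \<noteq> {}" for S
      using that k by (intro wrong) auto
  qed (use k in auto)
  then show ?thesis by simp
qed

end
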